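(* Let $P$ be an ergodic Markov kernel on a finite set $\mathcal X$, reversible with respect to the strictly positive probability distribution $\pi$. Let $\eta_1$ be the smallest eigenvalue of $P^2$ on $\ell^2_0(\pi)$ and let $\phi\in\ell^2_0(\pi)$ satisfy $P^2\phi=\eta_1\phi$ and $\|\phi\|_\pi=1$. For $\varnothing\ne S\subsetneq\mathcal X$ put $\delta(S)=\|(I-G_S)\phi\|_\pi^2$. Then there is a minimizer of $\delta(S)$ over all nonempty proper subsets $S\subsetneq\mathcal X$ that is a threshold set of $\phi$.
   Context: $\mathcal X$ is a finite set with $n=|\mathcal X|\ge 3$ and $\pi(x)>0$ for all $x$. $\ell^2(\pi)$ is the space of real functions on $\mathcal X$ with $\langle f,g\rangle_\pi=\sum_x\pi(x)f(x)g(x)$ and norm $\|\cdot\|_\pi$; $\ell^2_0(\pi)=\{f:\sum_x\pi(x)f(x)=0\}$. Kernels act by $(Pf)(x)=\sum_yP(x,y)f(y)$. Ergodic means irreducible and aperiodic; reversible means $\pi(x)P(x,y)=\pi(y)P(y,x)$ for all $x,y$. For $\varnothing\ne S\subsetneq\mathcal X$, $G_S$ is the operator replacing a function by its $\pi$-weighted mean on each of $S$ and $S^c$: $(G_Sf)(x)=\frac1{\pi(S)}\sum_{y\in S}\pi(y)f(y)$ if $x\in S$ and $(G_Sf)(x)=\frac1{\pi(S^c)}\sum_{y\in S^c}\pi(y)f(y)$ if $x\in S^c$. A nonempty proper set $S\subsetneq\mathcal X$ is a threshold set of $\phi$ if there is $\tau\in\mathbb R$ with $\{x:\phi(x)<\tau\}\subseteq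 S\subseteq\{x:\phi(x)\le\tau\}$. *)

theory Defs
  imports Complex_Main
begin

(* The finite state space is a type 'a of class finite; a kernel is its matrix of entries P x y. *)

definition markov_kernel :: "('a::finite \<Rightarrow> 'a \<Rightarrow> real) \<Rightarrow> bool" where
  "markov_kernel P \<longleftrightarrow> (\<forall>x y. 0 \<le> P x y) \<and> (\<forall>x. (\<Sum>y\<in>UNIV. P x y) = 1)"

definition prob_dist :: "('a::finite \<Rightarrow> real) \<Rightarrow> bool" where
  "prob_dist \<pi> \<longleftrightarrow> (\<forall>x. 0 \<le> \<pi> x) \<and> (\<Sum>x\<in>UNIV. \<pi> x) = 1"

definition kernel_app :: "('a::finite \<Rightarrow> 'a \<Rightarrow> real) \<Rightarrow> ('a \<Rightarrow> real) \<Rightarrow> 'a \<Rightarrow> real" where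
  "kernel_app P f = (\<lambda>x. \<Sum>y\<in>UNIV. P x y * f y)"

primrec kernel_pow :: "('a::finite \<Rightarrow> 'a \<Rightarrow> real) \<Rightarrow> nat \<Rightarrow> 'a \<Rightarrow> 'a \<Rightarrow> real" where
  "kernel_pow P 0 = (\<lambda>x y. if x = y then 1 else 0)"
| "kernel_pow P (Suc n) = (\<lambda>x y. \<Sum>z\<in>UNIV. P x z * kernel_pow P n z y)"

definition irreducible_kernel :: "('a::finite \<Rightarrow> 'a \<Rightarrow> real) \<Rightarrow> bool" where
  "irreducible_kernel P \<longleftrightarrow> (\<forall>x y. \<exists>n. 0 < kernel_pow P n x y)"

definition aperiodic_kernel :: "('a::finite \<Rightarrow> 'a \<Rightarrow> real) \<Rightarrow> bool" where
  "aperiodic_kernel P \<longleftrightarrow> (\<forall>x. Gcd {n. 1 \<le> n \<and> 0 < kernel_pow P n x x} = 1)"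

definition ergodic_kernel :: "('a::finite \<Rightarrow> 'a \<Rightarrow> real) \<Rightarrow> bool" where
  "ergodic_kernel P \<longleftrightarrow> irreducible_kernel P \<and> aperiodic_kernel P"

definition reversible :: "('a::finite \<Rightarrow> real) \<Rightarrow> ('a \<Rightarrow> 'a \<Rightarrow> real) \<Rightarrow> bool" where
  "reversible \<pi> P \<longleftrightarrow> (\<forall>x y. \<pi> x * P x y = \<pi> y * P y x)"

definition inner_wt :: "('a::finite \<Rightarrow> real) \<Rightarrow> ('a \<Rightarrow> real) \<Rightarrow> ('a \<Rightarrow> real) \<Rightarrow> real" where
  "inner_wt \<pi> f g = (\<Sum>x\<in>UNIV. \<pi> x * f x * g x)"

definition norm_wt :: "('a::finite \<Rightarrow> real) \<Rightarrow> ('a \<Rightarrow> real) \<Rightarrow> real" where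
  "norm_wt \<pi> f = sqrt (inner_wt \<pi> f f)"

definition mean_zero :: "('a::finite \<Rightarrow> real) \<Rightarrow> ('a \<Rightarrow> real) set" where
  "mean_zero \<pi> = {f. (\<Sum>x\<in>UNIV. \<pi> x * f x) = 0}"

definition eigenvalue_on ::
  "('a \<Rightarrow> real) set \<Rightarrow> (('a \<Rightarrow> real) \<Rightarrow> 'a \<Rightarrow> real) \<Rightarrow> real \<Rightarrow> bool" where
  "eigenvalue_on V T l \<longleftrightarrow> (\<exists>f\<in>V. f \<noteq> (\<lambda>x. 0) \<and> T f = (\<lambda>x. l * f x))"

definition smallest_eigenvalue_on ::
  "('a \<Rightarrow> real) set \<Rightarrow> (('a \<Rightarrow> real) \<Rightarrow> 'a \<Rightarrow> real) \<Rightarrow> real \<Rightarrow> bool" where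
  "smallest_eigenvalue_on V T l \<longleftrightarrow> eigenvalue_on V T l \<and> (\<forall>m. eigenvalue_on V T m \<longrightarrow> l \<le> m)"

definition wt_mean :: "('a::finite \<Rightarrow> real) \<Rightarrow> 'a set \<Rightarrow> ('a \<Rightarrow> real) \<Rightarrow> real" where
  "wt_mean \<pi> S f = (\<Sum>y\<in>S. \<pi> y * f y) / (\<Sum>y\<in>S. \<pi> y)"

(* The operator G_S; meaningful only for nonempty proper S, since wt_mean is 0 on the empty set. *)
definition block_avg :: "('a::finite \<Rightarrow> real) \<Rightarrow> 'a set \<Rightarrow> ('a \<Rightarrow> real) \<Rightarrow> 'a \<Rightarrow> real" where
  "block_avg \<pi> S f = (\<lambda>x. if x \<in> S then wt_mean \<pi> S f else wt_mean \<pi> (- S) f)"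

definition cut_defect :: "('a::finite \<Rightarrow> real) \<Rightarrow> ('a \<Rightarrow> real) \<Rightarrow> 'a set \<Rightarrow> real" where
  "cut_defect \<pi> \<phi> S = (norm_wt \<pi> (\<lambda>x. \<phi> x - block_avg \<pi> S \<phi> x))\<^sup>2"

definition nonempty_proper :: "'a set \<Rightarrow> bool" where
  "nonempty_proper S \<longleftrightarrow> S \<noteq> {} \<and> S \<noteq> UNIV"

definition threshold_set :: "('a \<Rightarrow> real) \<Rightarrow> 'a set \<Rightarrow> bool" where
  "threshold_set \<phi> S \<longleftrightarrow> nonempty_proper S \<and>
     (\<exists>\<tau>. {x. \<phi> x < \<tau>} \<subseteq> S \<and> S \<subseteq> {x. \<phi> x \<le> \<tau>})"

end

theory Submission
  imports Defs
begin

text \<open>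
  The number \<open>\<delta>(S)\<close> is the least cost of approximating \<open>\<phi>\<close> in \<open>\<ell>\<^sup>2(\<pi>)\<close> by a function constant on
  \<open>S\<close> and on its complement, so the claim is about one-dimensional 2-means clustering.
  Take a minimizer \<open>S\<close> with block means \<open>a\<close> and \<open>b\<close>; by symmetry
  \<open>a \<le> b\<close>. If \<open>a < b\<close>, reassigning every point to the nearer of \<open>a\<close> and \<open>b\<close> does not increase the
  cost, and it produces the set \<open>\<phi> < (a + b) / 2\<close>. If \<open>a = b\<close>, the cost is that of a constant
  function, hence every cut is a minimizer, in particular the singleton of a minimum point of \<open>\<phi>\<close>.
\<close>

text \<open>Clears the denominator of \<open>wt_mean\<close>. For empty \<open>S\<close> both sides
  are 0, so the identity covers every block.\<close>

lemma sum_wt_mean: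
  fixes \<pi> :: "'a::finite \<Rightarrow> real"
  assumes "\<And>x. \<pi> x > 0"
  shows "(\<Sum>y\<in>S. \<pi> y * f y) = wt_mean \<pi> S f * (\<Sum>y\<in>S. \<pi> y)"
proof (cases "S = {}")
  case False
  then have "(\<Sum>y\<in>S. \<pi> y) > 0"
    by (intro sum_pos) (auto simp: assms)
  then show ?thesis
    by (simp add: wt_mean_def)
qed simp

text \<open>The cost is quadratic in the constant, and the cross term vanishes at the mean: moving
  from the mean \<open>m\<close> to \<open>c\<close> adds exactly \<open>(m - c)\<^sup>2\<close>
  times the mass of \<open>S\<close>.\<close>

lemma wt_mean_minimizes:
  fixes \<pi> :: "'a::finite \<Rightarrow> real"
  assumes "\<And>x. \<pi> x > 0"
  shows "(\<Sum>y\<in>S. \<pi> y * (f y - wt_mean \<pi> S f)\<^sup>2) \<le> (\<Sum>y\<in>S. \<pi> y * (f y - c)\<^sup>2)"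
proof -
  define m where "m = wt_mean \<pi> S f"
  have expand: "(\<Sum>y\<in>S. \<pi> y * (f y - t)\<^sup>2)
      = (\<Sum>y\<in>S. \<pi> y * (f y)\<^sup>2) - 2 * t * (\<Sum>y\<in>S. \<pi> y * f y) + t\<^sup>2 * (\<Sum>y\<in>S. \<pi> y)" for t
  proof -
    have "(\<Sum>y\<in>S. \<pi> y * (f y - t)\<^sup>2)
        = (\<Sum>y\<in>S. \<pi> y * (f y)\<^sup>2 - 2 * t * (\<pi> y * f y) + t\<^sup>2 * \<pi> y)"
      by (intro sum.cong refl) (simp add: power2_eq_square algebra_simps)
    then show ?thesis
      by (simp only: sum.distrib sum_subtractf sum_distrib_left)
  qed
  have "(\<Sum>y\<in>S. \<pi> y * (f y - c)\<^sup>2) - (\<Sum>y\<in>S. \<pi> y * (f y - m)\<^sup>2)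
      = (m - c)\<^sup>2 * (\<Sum>y\<in>S. \<pi> y)"
    unfolding expand sum_wt_mean [of \<pi>, OF assms, where S = S and f = f] m_def [symmetric]
    by (simp add: power2_eq_square algebra_simps)
  also have "\<dots> \<ge> 0"
    by (simp add: sum_nonneg assms [THEN less_imp_le])
  finally show ?thesis
    by (simp add: m_def)
qed

lemma wt_mean_ge_some:
  fixes \<pi> :: "'a::finite \<Rightarrow> real"
  assumes "\<And>x. \<pi> x > 0" and "S \<noteq> {}"
  shows "\<exists>x\<in>S. f x \<le> wt_mean \<pi> S f"
proof (rule ccontr)
  assume "\<not> ?thesis"
  then have "(\<Sum>y\<in>S. \<pi> y * wt_mean \<pi> S f) < (\<Sum>y\<in>S. \<pi> y * f y)"
    using assms by (intro sum_strict_mono) (auto simp: not_le)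
  then show False
    by (simp only: sum_wt_mean [of \<pi>, OF assms(1), where S = S and f = f] sum_distrib_right [symmetric] mult.commute)
qed

lemma wt_mean_le_some:
  fixes \<pi> :: "'a::finite \<Rightarrow> real"
  assumes "\<And>x. \<pi> x > 0" and "S \<noteq> {}"
  shows "\<exists>x\<in>S. wt_mean \<pi> S f \<le> f x"
proof -
  obtain x where "x \<in> S" "- f x \<le> wt_mean \<pi> S (\<lambda>x. - f x)"
    using wt_mean_ge_some [of \<pi>, OF assms, where f = "\<lambda>x. - f x"] by blast
  moreover have "wt_mean \<pi> S (\<lambda>x. - f x) = - wt_mean \<pi> S f"
    by (simp add: wt_mean_def sum_negf)
  ultimately show ?thesis
    by auto
qed

lemma cut_defect_eq:
  fixes \<pi> :: "'a::finite \<Rightarrow> real"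
  assumes "\<And>x. \<pi> x > 0"
  shows "cut_defect \<pi> \<phi> S = (\<Sum>x\<in>UNIV. \<pi> x * (\<phi> x - block_avg \<pi> S \<phi> x)\<^sup>2)"
proof -
  \<comment> \<open>Nonnegativity lets the square cancel the root in \<open>norm_wt\<close>.\<close>
  have "0 \<le> (\<Sum>x\<in>UNIV. \<pi> x * (\<phi> x - block_avg \<pi> S \<phi> x)\<^sup>2)"
    by (simp add: sum_nonneg assms [THEN less_imp_le])
  then show ?thesis
    by (simp add: cut_defect_def norm_wt_def inner_wt_def power2_eq_square mult.assoc)
qed

lemma sum_split_block:
  fixes g :: "'a::finite \<Rightarrow> real \<Rightarrow> real"
  shows "(\<Sum>x\<in>UNIV. g x (if x \<in> S then a else b)) = (\<Sum>x\<in>S. g x a) + (\<Sum>x\<in>-S. g x b)"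
proof -
  have "(\<Sum>x\<in>UNIV. g x (if x \<in> S then a else b)) = (\<Sum>x\<in>UNIV. if x \<in> S then g x a else g x b)"
    by (rule sum.cong) auto
  then show ?thesis
    by (simp add: sum.If_cases)
qed

text \<open>Each block mean is optimal on its own block. Since \<open>a\<close> and \<open>b\<close>
  are arbitrary, the means of one cut can bound the defect of another.\<close>

lemma cut_defect_le:
  fixes \<pi> :: "'a::finite \<Rightarrow> real"
  assumes "\<And>x. \<pi> x > 0"
  shows "cut_defect \<pi> \<phi> S \<le> (\<Sum>x\<in>UNIV. \<pi> x * (\<phi> x - (if x \<in> S then a else b))\<^sup>2)"
  unfolding cut_defect_eq [of \<pi>, OF assms] block_avg_def
    sum_split_block [where g = "\<lambda>x t. \<pi> x * (\<phi> x - t)\<^sup>2"]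
  by (intro add_mono wt_mean_minimizes assms)

lemma cut_defect_Compl: "cut_defect \<pi> \<phi> (- S) = cut_defect \<pi> \<phi> S"
proof -
  have "block_avg \<pi> (- S) \<phi> = block_avg \<pi> S \<phi>"
    by (auto simp: block_avg_def)
  then show ?thesis
    by (simp add: cut_defect_def)
qed

lemma threshold_set_min_singleton:
  assumes "card (UNIV :: 'a::finite set) \<ge> 2"
  shows "\<exists>S. threshold_set (\<phi> :: 'a \<Rightarrow> real) S"
proof -
  obtain x where x: "\<And>y. \<phi> x \<le> \<phi> y"
    using ex_is_arg_min_if_finite [of UNIV \<phi>] by (auto simp: is_arg_min_def not_less)
  have "{x} \<noteq> UNIV"
  proof
    assume "{x} = UNIV"
    then have "card (UNIV :: 'a set) = card {x}"
      by simp
    with assms show False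
      by simp
  qed
  \<comment> \<open>With the minimum value as threshold, no point lies strictly below it.\<close>
  then have "threshold_set \<phi> {x}"
    using x by (auto simp: threshold_set_def nonempty_proper_def not_less leD intro!: exI [of _ "\<phi> x"])
  then show ?thesis ..
qed

lemma threshold_set_cut_defect_le:
  fixes \<pi> :: "'a::finite \<Rightarrow> real"
  assumes pos: "\<And>x. \<pi> x > 0" and card: "card (UNIV :: 'a set) \<ge> 2"
    and S: "nonempty_proper S" and le: "wt_mean \<pi> S \<phi> \<le> wt_mean \<pi> (- S) \<phi>"
  shows "\<exists>T. threshold_set \<phi> T \<and> cut_defect \<pi> \<phi> T \<le> cut_defect \<pi> \<phi> S"
proof -
  define a b where "a = wt_mean \<pi> S \<phi>" and "b = wt_mean \<pi> (- S) \<phi>"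
  have defect: "cut_defect \<pi> \<phi> S = (\<Sum>x\<in>UNIV. \<pi> x * (\<phi> x - (if x \<in> S then a else b))\<^sup>2)"
    by (simp add: cut_defect_eq [of \<pi>, OF pos] block_avg_def a_def b_def cong: if_cong)
  show ?thesis
  proof (cases "a = b")
    case True
    obtain T where "threshold_set \<phi> T"
      using threshold_set_min_singleton [OF card] ..
    moreover have "cut_defect \<pi> \<phi> T \<le> cut_defect \<pi> \<phi> S"
      using cut_defect_le [of \<pi>, OF pos, where S = T and a = a and b = a and \<phi> = \<phi>] True defect by (simp cong: if_cong)
    ultimately show ?thesis
      by blast
  next
    case False
    then have ab: "a < b"
      using le by (simp add: a_def b_def)
    define T where "T = {x. \<phi> x < (a + b) / 2}"
    \<comment> \<open>These points lie on opposite sides of the midpoint, so \<open>T\<close> is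
      nonempty and proper.\<close>
    obtain x y where "\<phi> x \<le> a" "b \<le> \<phi> y"
      using wt_mean_ge_some [of \<pi>, OF pos, where S = S and f = \<phi>] wt_mean_le_some [of \<pi>, OF pos, where S = "- S" and f = \<phi>] S
      by (auto simp: a_def b_def nonempty_proper_def)
    with ab have "x \<in> T" "y \<notin> T"
      by (auto simp: T_def)
    then have "threshold_set \<phi> T"
      by (auto simp: threshold_set_def nonempty_proper_def T_def intro!: exI [of _ "(a + b) / 2"])
    moreover have "cut_defect \<pi> \<phi> T \<le> cut_defect \<pi> \<phi> S"
    proof -
      have "(\<phi> x - (if x \<in> T then a else b))\<^sup>2 \<le> (\<phi> x - (if x \<in> S then a else b))\<^sup>2" for x
      proof -
        \<comment> \<open>The difference of the squared distances is linear in
          \<open>\<phi> x\<close> and changes sign at the midpoint, so \<open>T\<close> sends each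
          point to the nearer of \<open>a\<close> and \<open>b\<close>.\<close>
        have "(\<phi> x - b)\<^sup>2 - (\<phi> x - a)\<^sup>2 = 2 * (b - a) * ((a + b) / 2 - \<phi> x)"
          by (simp add: power2_eq_square field_simps)
        moreover have "2 * (b - a) * ((a + b) / 2 - \<phi> x) \<ge> 0" if "x \<in> T"
          using ab that by (intro mult_nonneg_nonneg) (auto simp: T_def)
        moreover have "2 * (b - a) * ((a + b) / 2 - \<phi> x) \<le> 0" if "x \<notin> T"
          using ab that by (intro mult_nonneg_nonpos) (auto simp: T_def)
        ultimately show ?thesis
          by (auto split: if_splits)
      qed
      then have "(\<Sum>x\<in>UNIV. \<pi> x * (\<phi> x - (if x \<in> T then a else b))\<^sup>2) \<le> cut_defect \<pi> \<phi> S"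
        unfolding defect by (intro sum_mono mult_left_mono) (auto simp: pos [THEN less_imp_le])
      \<comment> \<open>Replacing \<open>a\<close> and \<open>b\<close> by the block means of
        \<open>T\<close> itself can only lower the cost further.\<close>
      then show ?thesis
        using cut_defect_le [of \<pi>, OF pos, where S = T and a = a and b = b and \<phi> = \<phi>] by linarith
    qed
    ultimately show ?thesis
      by blast
  qed
qed

theorem lemma3p1:
  fixes P :: "'a::finite \<Rightarrow> 'a \<Rightarrow> real"
    and \<pi> :: "'a \<Rightarrow> real"
    and \<eta>\<^sub>1 :: real
    and \<phi> :: "'a \<Rightarrow> real"
  assumes "card (UNIV :: 'a set) \<ge> 3"
    and "prob_dist \<pi>" and "\<And>x. \<pi> x > 0"
    and "markov_kernel P" and "ergodic_kernel P" and "reversible \<pi> P"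
    and "smallest_eigenvalue_on (mean_zero \<pi>) (kernel_app (kernel_pow P 2)) \<eta>\<^sub>1"
    and "\<phi> \<in> mean_zero \<pi>"
    and "kernel_app (kernel_pow P 2) \<phi> = (\<lambda>x. \<eta>\<^sub>1 * \<phi> x)"
    and "norm_wt \<pi> \<phi> = 1"
  shows "\<exists>S. is_arg_min (cut_defect \<pi> \<phi>) nonempty_proper S \<and> threshold_set \<phi> S"
proof -
  have card: "card (UNIV :: 'a set) \<ge> 2"
    using assms(1) by simp
  have "Collect (nonempty_proper :: 'a set \<Rightarrow> bool) \<noteq> {}"
    using threshold_set_min_singleton [OF card] unfolding threshold_set_def by blast
  then obtain S where S: "is_arg_min (cut_defect \<pi> \<phi>) nonempty_proper S"
    using ex_is_arg_min_if_finite [of "Collect nonempty_proper" "cut_defect \<pi> \<phi>"] by auto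
  then have np: "nonempty_proper S" "nonempty_proper (- S)"
    by (auto simp: is_arg_min_def nonempty_proper_def)
  obtain T where T: "threshold_set \<phi> T" "cut_defect \<pi> \<phi> T \<le> cut_defect \<pi> \<phi> S"
  \<comment> \<open>Passing to the complement swaps the two means and keeps the defect, so either
    order of the means reduces to the same lemma.\<close>
  proof (cases "wt_mean \<pi> S \<phi> \<le> wt_mean \<pi> (- S) \<phi>")
    case True
    then show thesis
      using threshold_set_cut_defect_le [of \<pi>, OF assms(3) card np(1)] that by blast
  next
    case False
    then have "wt_mean \<pi> (- S) \<phi> \<le> wt_mean \<pi> (- (- S)) \<phi>"
      by simp
    then show thesis
      using threshold_set_cut_defect_le [of \<pi>, OF assms(3) card np(2)] that
      unfolding cut_defect_Compl by blast
  qed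
  then have "is_arg_min (cut_defect \<pi> \<phi>) nonempty_proper T"
    using S by (force simp: is_arg_min_def threshold_set_def)
  with T show ?thesis
    by blast
qed

end
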